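(* For every coalition $C\subseteq N$ and formulas $\varphi,\psi$, $\models\mathrm{Iab}_C(\varphi\rightarrow\psi)\rightarrow(\mathrm{Iab}_C\neg\varphi\wedge\mathrm{Iab}_C\psi)$.
   Context: $N$ is a finite non-empty set of agents; a coalition is any $C\subseteq N$, $\overline{C}=N\setminus C$. Formulas: $\varphi ::= p \mid \neg\varphi \mid (\varphi\wedge\psi) \mid [C]\varphi \mid \mathrm{Iab}_C\varphi$ over a countable set $\mathrm{Prop}$ of variables, with $\vee,\rightarrow,\leftrightarrow,\top,\bot$ as usual. A coalition model is $\mathcal{M}=(S,\{Act_i\}_{i\in N},o,V)$ with $S$ non-empty, each $Act_i$ non-empty, $o:S\times\prod_{i\in N}Act_i\to S$, $V:\mathrm{Prop}\to 2^S$; $Act_C=\prod_{i\in C}Act_i$ ($Act_\emptyset$ contains only the empty profile). $\mathcal{M},s\models[C]\varphi$ iff there is $\sigma_C\in Act_C$ such that for all $\sigma_{\overline{C}}\in Act_{\overline{C}}$, $\mathcal{M},o(s,\sigma_C,\sigma_{\overline{C}})\models\varphi$; $\mathcal{M},s\models\mathrm{Iab}_C\varphi$ iff $\mathcal{M},s\not\models[C]\varphi$; atoms and Boolean connectives as usual. $\models\varphi$ means $\varphi$ holds at every state of every coalition model over $N$. *)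

theory Defs
  imports Main "HOL-Library.FuncSet" "HOL-Library.Countable"
begin

text \<open>The finite non-empty set of agents is the universe of a type \<open>'i::finite\<close>, so every
  \<open>C :: 'i set\<close> is a coalition and \<open>- C\<close> is the complementary coalition.\<close>

datatype ('i, 'p) fm =
    Atom 'p
  | Neg "('i, 'p) fm"
  | Conj "('i, 'p) fm" "('i, 'p) fm"
  | Coop "'i set" "('i, 'p) fm"   \<comment> \<open>\<open>[C]\<phi>\<close>\<close>
  | Iab "'i set" "('i, 'p) fm"

definition Imp :: "('i, 'p) fm \<Rightarrow> ('i, 'p) fm \<Rightarrow> ('i, 'p) fm" where
  "Imp \<phi> \<psi> = Neg (Conj \<phi> (Neg \<psi>))"

record ('s, 'i, 'a, 'p) model =
  states :: "'s set"
  Act :: "'i \<Rightarrow> 'a set"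
  outcome :: "'s \<Rightarrow> ('i \<Rightarrow> 'a) \<Rightarrow> 's"
  val :: "'p \<Rightarrow> 's set"

definition profiles :: "('s, 'i, 'a, 'p) model \<Rightarrow> 'i set \<Rightarrow> ('i \<Rightarrow> 'a) set" where
  "profiles M C = (\<Pi>\<^sub>E i\<in>C. Act M i)"

definition coalition_model :: "('s, 'i::finite, 'a, 'p) model \<Rightarrow> bool" where
  "coalition_model M \<longleftrightarrow>
     states M \<noteq> {} \<and>
     (\<forall>i. Act M i \<noteq> {}) \<and>
     (\<forall>s\<in>states M. \<forall>\<sigma>\<in>profiles M UNIV. outcome M s \<sigma> \<in> states M) \<and>
     (\<forall>p. val M p \<subseteq> states M)"

text \<open>\<open>override_on \<tau> \<sigma> C\<close> is the full profile that agrees with \<open>\<sigma>\<close> on \<open>C\<close> and with \<open>\<tau>\<close> on \<open>- C\<close>.\<close>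

definition can_ensure ::
    "('s, 'i::finite, 'a, 'p) model \<Rightarrow> 's \<Rightarrow> 'i set \<Rightarrow> ('s \<Rightarrow> bool) \<Rightarrow> bool" where
  "can_ensure M s C P \<longleftrightarrow>
     (\<exists>\<sigma>\<in>profiles M C. \<forall>\<tau>\<in>profiles M (- C). P (outcome M s (override_on \<tau> \<sigma> C)))"

primrec sat :: "('s, 'i::finite, 'a, 'p) model \<Rightarrow> ('i, 'p) fm \<Rightarrow> 's \<Rightarrow> bool" where
  "sat M (Atom p) = (\<lambda>s. s \<in> val M p)"
| "sat M (Neg \<phi>) = (\<lambda>s. \<not> sat M \<phi> s)"
| "sat M (Conj \<phi> \<psi>) = (\<lambda>s. sat M \<phi> s \<and> sat M \<psi> s)"
| "sat M (Coop C \<phi>) = (\<lambda>s. can_ensure M s C (sat M \<phi>))"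
| "sat M (Iab C \<phi>) = (\<lambda>s. \<not> can_ensure M s C (sat M \<phi>))"

text \<open>HOL cannot quantify over types inside a formula, so validity takes as parameters the types
  from which the states and the actions are drawn. A theorem that leaves \<open>'s\<close> and \<open>'a\<close> as type
  variables ranges over all coalition models.\<close>

definition valid :: "'s itself \<Rightarrow> 'a itself \<Rightarrow> ('i::finite, 'p) fm \<Rightarrow> bool" where
  "valid _ _ \<phi> \<longleftrightarrow>
     (\<forall>M :: ('s, 'i, 'a, 'p) model. coalition_model M \<longrightarrow> (\<forall>s\<in>states M. sat M \<phi> s))"

end

theory Submission
  imports Defs
begin

text \<open>Ability is monotone: the same joint action of \<open>C\<close> that forces
  \<open>P\<close> forces anything weaker. Both the negation of \<open>\<phi>\<close> and
  \<open>\<psi>\<close> entail the implication at every state, so ability for either would give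
  ability for the implication; contraposition yields both inabilities.\<close>

lemma can_ensure_mono:
  assumes "can_ensure M s C P" and "\<And>t. P t \<Longrightarrow> Q t"
  shows "can_ensure M s C Q"
  using assms unfolding can_ensure_def by blast

lemma sat_Imp [simp]: "sat M (Imp \<phi> \<psi>) s \<longleftrightarrow> (sat M \<phi> s \<longrightarrow> sat M \<psi> s)"
  by (simp add: Imp_def)

theorem theorem4p14:
  fixes C :: "'i::finite set" and \<phi> \<psi> :: "('i, 'p::countable) fm"
  shows "valid TYPE('s) TYPE('a) (Imp (Iab C (Imp \<phi> \<psi>)) (Conj (Iab C (Neg \<phi>)) (Iab C \<psi>)))"
  \<comment> \<open>\<open>Q\<close> does not occur in the major premise, so it is fixed to the
    predicate in the inability hypothesis; \<open>sat_Imp\<close> settles the pointwise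
    entailment.\<close>
  unfolding valid_def by (auto dest: can_ensure_mono[where Q = "sat _ (Imp \<phi> \<psi>)"])

end
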